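(* For every dimension $n \geq 1$ there exists a constant $c_n > 0$, depending only on $n$, such that the following holds. Let $\Omega \subset \mathbb{R}^n$ be a bounded open set with smooth boundary, let $V \in C^2(\Omega)$ with $V \geq 0$, and let $\phi$ be a real-valued, not identically zero solution of $(-\Delta + V)\phi = \lambda \phi$ in $\Omega$ with Dirichlet boundary conditions. Let $c > 0$ and let $x_0 \in \Omega$ with $\phi(x_0) \neq 0$. Suppose that the ball $$ B = B\left(x_0, \frac{c_n}{\sqrt{c}} \sqrt{\frac{\lambda}{c} + \log\left(c_n \frac{\|\phi\|_{L^\infty}}{|\phi(x_0)|}\right)}\right)$$ satisfies $B \subset \Omega$, and that either $V(x) - \lambda \geq c$ for all $x \in B$, or $V(x) - \lambda \leq -c$ for all $x \in B$. Then $$ \frac{\sup_{x \in B} |\phi(x)|}{\inf_{x \in B} |\phi(x)|} \geq 2.$$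
   Context: $B(x_0,r)$ denotes the Euclidean ball of radius $r$ centered at $x_0$, and $\|\phi\|_{L^\infty}$ is the supremum norm of $\phi$ over $\Omega$. Solutions are understood classically: $\phi \in C^2(\Omega)\cap C(\overline{\Omega})$ with $\phi = 0$ on $\partial\Omega$. If $\inf_{x\in B}|\phi(x)| = 0$, the quotient in the conclusion is interpreted as $+\infty$. *)

theory Defs
  imports "HOL-Analysis.Analysis"
begin

definition partial_deriv ::
    "'a::euclidean_space \<Rightarrow> ('a \<Rightarrow> real) \<Rightarrow> 'a \<Rightarrow> real"
  where "partial_deriv b f x = frechet_derivative f (at x) b"

(* Intended for open S only: derivatives are taken with respect to a full
   neighbourhood of each point of S. *)
fun Ck_on :: "nat \<Rightarrow> ('a::euclidean_space \<Rightarrow> real) \<Rightarrow> 'a set \<Rightarrow> bool" where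
  "Ck_on 0 f S \<longleftrightarrow> continuous_on S f"
| "Ck_on (Suc k) f S \<longleftrightarrow>
     (\<forall>x\<in>S. f differentiable (at x)) \<and> (\<forall>b\<in>Basis. Ck_on k (partial_deriv b f) S)"

definition smooth_fun_on :: "('a::euclidean_space \<Rightarrow> real) \<Rightarrow> 'a set \<Rightarrow> bool"
  where "smooth_fun_on f S \<longleftrightarrow> (\<forall>k. Ck_on k f S)"

(* Near each boundary point, U is the region strictly above the graph of a
   smooth function over a hyperplane (with unit normal v). A function on the
   hyperplane is represented by a function g on the whole space evaluated at
   the orthogonal projection x - (x \<bullet> v) v. *)
definition smooth_boundary :: "'a::euclidean_space set \<Rightarrow> bool"
  where "smooth_boundary U \<longleftrightarrow>
    (\<forall>p\<in>frontier U. \<exists>r>0. \<exists>v g. norm v = 1 \<and> smooth_fun_on g UNIV \<and>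
       U \<inter> ball p r = {x \<in> ball p r. g (x - (x \<bullet> v) *\<^sub>R v) < x \<bullet> v})"

definition laplacian :: "('a::euclidean_space \<Rightarrow> real) \<Rightarrow> 'a \<Rightarrow> real"
  where "laplacian f x = (\<Sum>b\<in>Basis. partial_deriv b (partial_deriv b f) x)"

definition dirichlet_solution ::
    "'a::euclidean_space set \<Rightarrow> ('a \<Rightarrow> real) \<Rightarrow> real \<Rightarrow> ('a \<Rightarrow> real) \<Rightarrow> bool"
  where "dirichlet_solution U V l f \<longleftrightarrow>
    Ck_on 2 f U \<and> continuous_on (closure U) f \<and>
    (\<forall>x\<in>U. - laplacian f x + V x * f x = l * f x) \<and>
    (\<forall>x\<in>frontier U. f x = 0)"

definition sup_norm_on :: "'a set \<Rightarrow> ('a \<Rightarrow> real) \<Rightarrow> real"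
  where "sup_norm_on U f = (SUP x\<in>U. \<bar>f x\<bar>)"

(* Taken in ennreal, where a / 0 is infinite for a > 0. *)
definition sup_inf_quotient :: "'a set \<Rightarrow> ('a \<Rightarrow> real) \<Rightarrow> ennreal"
  where "sup_inf_quotient B f =
    (SUP x\<in>B. ennreal \<bar>f x\<bar>) / (INF x\<in>B. ennreal \<bar>f x\<bar>)"

end

theory Submission
  imports Defs
begin

text \<open>
  The argument is the maximum principle against a paraboloid. Where \<open>\<phi>\<close> has no zero, \<open>\<bar>\<phi>\<bar>\<close> satisfies
  \<open>\<Delta>\<bar>\<phi>\<bar> = (V - \<lambda>)\<bar>\<phi>\<bar>\<close>. Let \<open>m > 0\<close> be the infimum of \<open>\<bar>\<phi>\<bar>\<close> on the ball. Then \<open>\<Delta>\<bar>\<phi>\<bar>\<close> is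
  everywhere at least \<open>c m\<close>, or everywhere at most \<open>- c m\<close>. Any function with Laplacian at least
  \<open>c m\<close> on a ball of radius \<open>r\<close> about \<open>x\<^sub>0\<close> exceeds its central value by nearly \<open>c m r\<^sup>2 / (2 n)\<close>
  somewhere on the bounding sphere, because \<open>c m \<bar>x - x\<^sub>0\<bar>\<^sup>2 / (2 n)\<close> has Laplacian \<open>c m\<close>
  (\<open>sphere_gain\<close>). As soon as \<open>r\<^sup>2 > 2 n / c\<close> this gain is at least \<open>m\<close>. In the first case
  \<open>\<bar>\<phi>\<bar>\<close> therefore reaches \<open>\<bar>\<phi> x\<^sub>0\<bar> + m \<ge> 2 m\<close> on the sphere; in the second, applied to
  \<open>- \<bar>\<phi>\<bar>\<close>, the centre itself has \<open>\<bar>\<phi> x\<^sub>0\<bar> \<ge> m + m\<close>. If instead \<open>m = 0\<close>, the quotient is infinite.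

  It remains to see that the prescribed radius \<open>R\<close> satisfies \<open>R\<^sup>2 > 2 n / c\<close>. The maximum principle
  on all of \<open>\<Omega>\<close> gives \<open>\<lambda> \<ge> 0\<close> (\<open>dirichlet_eigenvalue_nonneg\<close>), and the supremum norm is at least
  \<open>\<bar>\<phi> x\<^sub>0\<bar>\<close>, so \<open>R\<^sup>2 \<ge> c\<^sub>n\<^sup>2 log c\<^sub>n / c\<close>; the constant \<open>c\<^sub>n = exp (2 n)\<close> is large enough.
\<close>

section \<open>Second derivatives at a maximum\<close>

text \<open>
  If \<open>d\<close> were positive, \<open>g'\<close>, which vanishes at \<open>0\<close>, would be positive just to the right of \<open>0\<close>, and
  \<open>g\<close> would rise above \<open>g 0\<close>.
\<close>

lemma second_derivative_nonpos_at_local_max: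
  fixes g g' :: "real \<Rightarrow> real"
  assumes e: "e > 0"
    and deriv: "\<And>t. \<bar>t\<bar> < e \<Longrightarrow> (g has_real_derivative g' t) (at t)"
    and deriv2: "(g' has_real_derivative d) (at 0)"
    and max: "\<And>t. \<bar>t\<bar> < e \<Longrightarrow> g t \<le> g 0"
  shows "d \<le> 0"
proof (rule ccontr)
  assume "\<not> d \<le> 0"
  have "g' 0 = 0"
    by (rule DERIV_local_max[OF deriv[of 0], of e]) (use e max in auto)
  moreover obtain \<delta> where \<delta>: "\<delta> > 0" "\<And>h. 0 < h \<Longrightarrow> h < \<delta> \<Longrightarrow> g' 0 < g' (0 + h)"
    using DERIV_pos_inc_right[OF deriv2] \<open>\<not> d \<le> 0\<close> by (metis linorder_not_le)
  ultimately have pos: "g' h > 0" if "0 < h" "h < \<delta>" for h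
    using that by force
  define t where "t = min \<delta> e / 2"
  have t: "0 < t" "t < \<delta>" "t < e"
    using \<delta>(1) e by (auto simp: t_def)
  obtain z where z: "0 < z" "z < t" "g t - g 0 = (t - 0) * g' z"
    using MVT2[of 0 t g g'] deriv t by force
  then have "g t > g 0"
    using pos[of z] t by (smt (verit) mult_pos_pos)
  with max[of t] t show False
    by force
qed

text \<open>
  The sign or weight \<open>s\<close> lets one statement serve for \<open>f\<close> and \<open>- f\<close>. Along each coordinate line
  through \<open>x\<close> the function \<open>s f - a \<bar>\<cdot> - z\<bar>\<^sup>2\<close> has a local maximum at \<open>x\<close>, so its second derivative
  there, \<open>s \<partial>\<^sub>b\<^sup>2 f - 2 a\<close>, is nonpositive; summing over the coordinates gives the bound.
\<close>

lemma laplacian_le_at_paraboloid_touching: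
  fixes f :: "'a::euclidean_space \<Rightarrow> real" and a s :: real
  assumes C2: "Ck_on 2 f U"
    and e: "e > 0" "ball x e \<subseteq> U"
    and max: "\<And>y. y \<in> ball x e \<Longrightarrow>
      s * f y - a * (norm (y - z))\<^sup>2 \<le> s * f x - a * (norm (x - z))\<^sup>2"
  shows "s * laplacian f x \<le> 2 * a * DIM('a)"
proof -
  have "s * partial_deriv b (partial_deriv b f) x \<le> 2 * a" if b: "b \<in> Basis" for b
  proof -
    have diff: "f differentiable (at y)" "partial_deriv b f differentiable (at y)" if "y \<in> U" for y
      using C2 that b by (auto simp: numeral_2_eq_2)
    have line: "((\<lambda>t. h (x + t *\<^sub>R b)) has_real_derivative partial_deriv b h (x + t *\<^sub>R b)) (at t)"
      if "h differentiable (at (x + t *\<^sub>R b))" for h t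
    proof -
      have h: "(h has_derivative frechet_derivative h (at (x + t *\<^sub>R b))) (at (x + t *\<^sub>R b))"
        using that frechet_derivative_works by blast
      have "((\<lambda>t. x + t *\<^sub>R b) has_derivative (\<lambda>u. u *\<^sub>R b)) (at t)"
        by (auto intro!: derivative_eq_intros)
      from has_derivative_compose[OF this h]
      have "((\<lambda>t. h (x + t *\<^sub>R b)) has_derivative
          (\<lambda>u. frechet_derivative h (at (x + t *\<^sub>R b)) (u *\<^sub>R b))) (at t)" .
      moreover have "frechet_derivative h (at (x + t *\<^sub>R b)) (u *\<^sub>R b)
          = partial_deriv b h (x + t *\<^sub>R b) * u" for u
        using linear_scale[OF has_derivative_linear[OF h]] by (simp add: partial_deriv_def)
      ultimately show ?thesis
        by (simp add: has_field_derivative_def)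
    qed
    have near: "x + t *\<^sub>R b \<in> ball x e" if "\<bar>t\<bar> < e" for t
      using that b by (simp add: dist_norm)
    define g where "g t = s * f (x + t *\<^sub>R b) - a * (norm (x + t *\<^sub>R b - z))\<^sup>2" for t
    define g' where "g' t = s * partial_deriv b f (x + t *\<^sub>R b) - 2 * a * ((x - z) \<bullet> b + t)" for t
    have "(norm (x + t *\<^sub>R b - z))\<^sup>2 = (norm (x - z))\<^sup>2 + 2 * t * ((x - z) \<bullet> b) + t\<^sup>2" for t
      using dot_norm[of "x - z" "t *\<^sub>R b"] b by (simp add: algebra_simps)
    then have g_eq: "g = (\<lambda>t. s * f (x + t *\<^sub>R b)
        - a * ((norm (x - z))\<^sup>2 + 2 * t * ((x - z) \<bullet> b) + t\<^sup>2))"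
      by (simp add: g_def fun_eq_iff)
    have "(g has_real_derivative g' t) (at t)" if "\<bar>t\<bar> < e" for t
      unfolding g_eq g'_def
      by (rule derivative_eq_intros line diff refl | use near that e in force
          | simp add: algebra_simps)+
    moreover have "(g' has_real_derivative s * partial_deriv b (partial_deriv b f) x - 2 * a) (at 0)"
    proof -
      have "x \<in> U"
        using near[of 0] e by auto
      then have "((\<lambda>t. partial_deriv b f (x + t *\<^sub>R b)) has_real_derivative
          partial_deriv b (partial_deriv b f) x) (at 0)"
        using line[of "partial_deriv b f" 0] diff(2)[of x] by simp
      then show ?thesis
        unfolding g'_def by (auto intro!: derivative_eq_intros)
    qed
    moreover have "g t \<le> g 0" if "\<bar>t\<bar> < e" for t
      using max[OF near[OF that]] by (simp add: g_def)
    ultimately show ?thesis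
      using second_derivative_nonpos_at_local_max[OF e(1), of g g'] by force
  qed
  then have "(\<Sum>b\<in>Basis. s * partial_deriv b (partial_deriv b f) x) \<le> (\<Sum>b\<in>(Basis::'a set). 2 * a)"
    by (rule sum_mono)
  then show ?thesis
    by (simp add: laplacian_def sum_distrib_left mult.commute)
qed

section \<open>Maximum principles\<close>

text \<open>
  Since \<open>a \<bar>\<cdot> - z\<bar>\<^sup>2\<close> has Laplacian \<open>2 a n\<close>, the difference \<open>s f - a \<bar>\<cdot> - z\<bar>\<^sup>2\<close> cannot attain its
  maximum over the closed ball in the interior. A maximum point thus lies on the sphere, where the
  paraboloid has the value \<open>a r\<^sup>2\<close>.
\<close>

lemma sphere_gain:
  fixes f :: "'a::euclidean_space \<Rightarrow> real" and a s :: real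
  assumes C2: "Ck_on 2 f U"
    and r: "r > 0" "cball z r \<subseteq> U"
    and lap: "\<And>x. x \<in> cball z r \<Longrightarrow> s * laplacian f x > 2 * a * DIM('a)"
  obtains y where "y \<in> cball z r" "s * f y \<ge> s * f z + a * r\<^sup>2"
proof -
  define w where "w x = s * f x - a * (norm (x - z))\<^sup>2" for x
  have "f differentiable (at x)" if "x \<in> cball z r" for x
    using C2 r that by (auto simp: numeral_2_eq_2)
  then have "continuous_on (cball z r) f"
    by (meson continuous_at_imp_continuous_on differentiable_imp_continuous_within)
  then have "continuous_on (cball z r) w"
    unfolding w_def by (intro continuous_intros)
  then obtain y where y: "y \<in> cball z r" "\<And>x. x \<in> cball z r \<Longrightarrow> w x \<le> w y"
    using continuous_attains_sup[OF compact_cball, of z r w] r by force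
  have "dist z y = r"
  proof (rule ccontr)
    assume "dist z y \<noteq> r"
    with y(1) have "y \<in> ball z r"
      by simp
    then obtain e where e: "e > 0" "ball y e \<subseteq> ball z r"
      using open_contains_ball[of "ball z r"] by blast
    have sub: "ball y e \<subseteq> cball z r"
      using e(2) ball_subset_cball by blast
    have "s * laplacian f y \<le> 2 * a * DIM('a)"
    proof (rule laplacian_le_at_paraboloid_touching[OF C2 e(1), where z = z])
      show "ball y e \<subseteq> U"
        using sub r by blast
      show "s * f x - a * (norm (x - z))\<^sup>2 \<le> s * f y - a * (norm (y - z))\<^sup>2" if "x \<in> ball y e" for x
        using y(2)[of x] sub that by (auto simp: w_def)
    qed
    with lap[OF y(1)] show False
      by simp
  qed
  moreover have "w z \<le> w y"
    using y r by simp
  ultimately have "s * f y \<ge> s * f z + a * r\<^sup>2"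
    by (simp add: w_def dist_norm norm_minus_commute)
  with y(1) that show thesis
    by blast
qed

text \<open>
  At an interior maximum of \<open>\<bar>\<phi>\<bar>\<close>, with \<open>s\<close> the sign of \<open>\<phi>\<close> there, \<open>(V - \<lambda>)\<bar>\<phi>\<bar> = s \<Delta>\<phi> \<le> 0\<close>, so
  \<open>\<lambda> \<ge> V \<ge> 0\<close> at that point.
\<close>

lemma dirichlet_eigenvalue_nonneg:
  fixes f :: "'a::euclidean_space \<Rightarrow> real"
  assumes U: "bounded U" "open U"
    and V: "\<And>x. x \<in> U \<Longrightarrow> V x \<ge> 0"
    and sol: "dirichlet_solution U V l f"
    and nz: "x1 \<in> U" "f x1 \<noteq> 0"
  shows "l \<ge> 0"
proof -
  have C2: "Ck_on 2 f U" and cont: "continuous_on (closure U) f"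
    and pde: "\<And>x. x \<in> U \<Longrightarrow> - laplacian f x + V x * f x = l * f x"
    and bc: "\<And>x. x \<in> frontier U \<Longrightarrow> f x = 0"
    using sol by (auto simp: dirichlet_solution_def)
  have "x1 \<in> closure U"
    using nz closure_subset by blast
  have "compact (closure U)"
    using U by simp
  moreover have "closure U \<noteq> {}"
    using nz by auto
  ultimately have "\<exists>x\<in>closure U. \<forall>y\<in>closure U. \<bar>f y\<bar> \<le> \<bar>f x\<bar>"
    using continuous_on_rabs[OF cont] by (rule continuous_attains_sup)
  then obtain x where x: "x \<in> closure U" "\<And>y. y \<in> closure U \<Longrightarrow> \<bar>f y\<bar> \<le> \<bar>f x\<bar>"
    by blast
  then have fx: "f x \<noteq> 0"
    using nz \<open>x1 \<in> closure U\<close> by fastforce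
  then have xU: "x \<in> U"
    using x(1) bc[of x] U interior_open[of U] by (auto simp: frontier_def)
  then obtain e where e: "e > 0" "ball x e \<subseteq> U"
    using U open_contains_ball by blast
  have "sgn (f x) * laplacian f x \<le> 2 * 0 * real DIM('a)"
  proof (rule laplacian_le_at_paraboloid_touching[OF C2 e, where z = x])
    fix y assume "y \<in> ball x e"
    then have "\<bar>f y\<bar> \<le> \<bar>f x\<bar>"
      using e closure_subset x(2) by blast
    then show "sgn (f x) * f y - 0 * (norm (y - x))\<^sup>2 \<le> sgn (f x) * f x - 0 * (norm (x - x))\<^sup>2"
      by (auto simp: sgn_if abs_if split: if_splits)
  qed
  moreover have "sgn (f x) * laplacian f x = (V x - l) * \<bar>f x\<bar>"
  proof -
    have "laplacian f x = (V x - l) * f x"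
      using pde[OF xU] by (simp add: algebra_simps)
    then show ?thesis
      by (simp add: abs_sgn)
  qed
  ultimately have "V x - l \<le> 0"
    using fx by (simp add: mult_le_0_iff)
  with V[OF xU] show ?thesis
    by simp
qed

section \<open>Doubling on large balls\<close>

lemma constant_sign_on_ball:
  fixes f :: "'a::real_normed_vector \<Rightarrow> real"
  assumes "continuous_on (ball z r) f" "\<And>x. x \<in> ball z r \<Longrightarrow> f x \<noteq> 0" "x \<in> ball z r"
  shows "\<bar>f x\<bar> = sgn (f z) * f x"
proof (rule ccontr)
  assume neq: "\<bar>f x\<bar> \<noteq> sgn (f z) * f x"
  have z: "z \<in> ball z r"
    using assms(3) le_less_trans[OF zero_le_dist] by auto
  have "is_interval (f ` ball z r)"
    using connected_continuous_image[OF assms(1)] connected_ball is_interval_connected_1 by blast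
  moreover have "f x < 0 \<and> 0 < f z \<or> f z < 0 \<and> 0 < f x"
    using neq assms(2)[OF z] assms(2)[OF assms(3)]
    by (auto simp: sgn_if abs_if not_less order.order_iff_strict split: if_splits)
  ultimately have "0 \<in> f ` ball z r"
    using z assms(3) unfolding is_interval_1 by (meson imageI less_imp_le)
  with assms(2) show False
    by force
qed

text \<open>
  In the exceptional case of a vanishing infimum the quotient is \<open>\<infinity>\<close> because \<open>f\<close> does not vanish at
  \<open>z\<close>. This leaves only functions bounded away from zero to be treated.
\<close>

lemma sup_inf_quotient_ge_2I:
  fixes f :: "'a \<Rightarrow> real"
  assumes z: "z \<in> B" "f z \<noteq> 0"
    and gain: "\<And>m. m > 0 \<Longrightarrow> (\<And>x. x \<in> B \<Longrightarrow> m \<le> \<bar>f x\<bar>) \<Longrightarrow> \<exists>y\<in>B. 2 * m \<le> \<bar>f y\<bar>"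
  shows "sup_inf_quotient B f \<ge> 2"
proof -
  define S where "S = (SUP x\<in>B. ennreal \<bar>f x\<bar>)"
  define I where "I = (INF x\<in>B. ennreal \<bar>f x\<bar>)"
  have Sz: "S \<ge> ennreal \<bar>f z\<bar>" and Iz: "I \<le> ennreal \<bar>f z\<bar>"
    unfolding S_def I_def using z by (auto intro: SUP_upper INF_lower)
  have "2 \<le> S / I"
  proof (cases "I = 0")
    case True
    moreover have "S \<noteq> 0"
      using Sz z(2) by (auto simp: ennreal_eq_0_iff)
    ultimately show ?thesis
      by simp
  next
    case False
    have "I \<noteq> top"
      using Iz by (auto simp: top_unique)
    then obtain m where m: "I = ennreal m" "m \<ge> 0"
      by (cases I) auto
    with False have mpos: "m > 0"
      by (cases "m = 0") auto
    have "m \<le> \<bar>f x\<bar>" if "x \<in> B" for x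
    proof -
      have "I \<le> ennreal \<bar>f x\<bar>"
        unfolding I_def using that by (rule INF_lower)
      then show ?thesis
        by (simp add: m)
    qed
    then obtain y where y: "y \<in> B" "2 * m \<le> \<bar>f y\<bar>"
      using gain mpos by blast
    have "2 * I = ennreal (2 * m)"
      using m by (simp add: ennreal_mult)
    also have "\<dots> \<le> ennreal \<bar>f y\<bar>"
      using y by (simp add: ennreal_leI)
    also have "\<dots> \<le> S"
      unfolding S_def using y by (auto intro: SUP_upper)
    finally have "2 * I / I \<le> S / I"
      by (rule divide_right_mono_ennreal)
    moreover have "2 * I / I = 2"
      using False \<open>I \<noteq> top\<close> by (simp add: ennreal_mult_divide_eq)
    ultimately show ?thesis
      by simp
  qed
  then show ?thesis
    by (simp add: sup_inf_quotient_def S_def I_def)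
qed

text \<open>
  The sign of \<open>f\<close> being constant, \<open>\<bar>f\<bar>\<close> satisfies the equation of \<open>f\<close>, and the radius is such that
  \<open>sphere_gain\<close> produces two points whose values of \<open>\<bar>f\<bar>\<close> differ by at least \<open>m\<close>: the centre is the smaller
  one if \<open>q \<ge> c\<close> and the larger one if \<open>q \<le> - c\<close>. As the smaller value is itself at least \<open>m\<close>, the
  larger is at least \<open>2 m\<close>.
\<close>

lemma doubling_on_large_ball:
  fixes f :: "'a::euclidean_space \<Rightarrow> real"
  assumes C2: "Ck_on 2 f U"
    and pde: "\<And>x. x \<in> U \<Longrightarrow> laplacian f x = q x * f x"
    and c: "c > 0" and r: "r > 0" and large: "r\<^sup>2 > 2 * real DIM('a) / c"
    and R: "r < R" "ball z R \<subseteq> U"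
    and q: "(\<forall>x\<in>ball z R. q x \<ge> c) \<or> (\<forall>x\<in>ball z R. q x \<le> - c)"
    and m: "m > 0" "\<And>x. x \<in> ball z R \<Longrightarrow> m \<le> \<bar>f x\<bar>"
  shows "\<exists>y\<in>ball z R. 2 * m \<le> \<bar>f y\<bar>"
proof -
  have sub: "cball z r \<subseteq> ball z R" "cball z r \<subseteq> U"
    using R by auto
  have z: "z \<in> ball z R"
    using r R by simp
  have "f differentiable (at x)" if "x \<in> ball z R" for x
    using C2 R that by (auto simp: numeral_2_eq_2)
  then have "continuous_on (ball z R) f"
    by (meson continuous_at_imp_continuous_on differentiable_imp_continuous_within)
  moreover have "f x \<noteq> 0" if "x \<in> ball z R" for x
    using m that by fastforce
  ultimately have abs: "\<bar>f x\<bar> = sgn (f z) * f x" if "x \<in> ball z R" for x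
    using constant_sign_on_ball that by blast
  have lap: "sgn (f z) * laplacian f x = q x * \<bar>f x\<bar>" if "x \<in> ball z R" for x
    using pde[of x] abs[OF that] R that by (auto simp: algebra_simps)
  \<comment> \<open>The curvature \<open>m / r\<^sup>2\<close> makes the gain on the sphere exactly \<open>m\<close>; that \<open>r\<close> is large makes the
    resulting Laplacian smaller than \<open>c m\<close>.\<close>
  define a where "a = m / r\<^sup>2"
  have gain: "a * r\<^sup>2 = m"
    using r by (simp add: a_def)
  have "2 * real DIM('a) < c * r\<^sup>2"
    using large c by (simp add: field_simps)
  then have "2 * real DIM('a) * m < c * r\<^sup>2 * m"
    using m by simp
  then have a: "2 * a * DIM('a) < c * m"
    using r by (simp add: a_def field_simps)
  have strong: "c * m \<le> c * \<bar>f x\<bar>" if "x \<in> ball z R" for x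
    using m that c by simp
  from q show ?thesis
  proof
    assume q: "\<forall>x\<in>ball z R. q x \<ge> c"
    have "sgn (f z) * laplacian f x > 2 * a * DIM('a)" if "x \<in> cball z r" for x
    proof -
      have x: "x \<in> ball z R"
        using that sub by blast
      then have "c * \<bar>f x\<bar> \<le> q x * \<bar>f x\<bar>"
        using q by (intro mult_right_mono) auto
      then show ?thesis
        using a strong[OF x] lap[OF x] by linarith
    qed
    then obtain y where y: "y \<in> cball z r" "sgn (f z) * f y \<ge> sgn (f z) * f z + a * r\<^sup>2"
      using sphere_gain[OF C2 r sub(2), where a = a and s = "sgn (f z)"] by blast
    have yB: "y \<in> ball z R"
      using y sub by blast
    show ?thesis
      using y(2) abs[OF yB] abs[OF z] m(2)[OF z] gain yB by (intro bexI[of _ y]) auto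
  next
    assume q: "\<forall>x\<in>ball z R. q x \<le> - c"
    have "- sgn (f z) * laplacian f x > 2 * a * DIM('a)" if "x \<in> cball z r" for x
    proof -
      have x: "x \<in> ball z R"
        using that sub by blast
      then have "q x * \<bar>f x\<bar> \<le> - c * \<bar>f x\<bar>"
        using q by (intro mult_right_mono) auto
      then show ?thesis
        using a strong[OF x] lap[OF x] by simp
    qed
    then obtain y where y: "y \<in> cball z r" "- sgn (f z) * f y \<ge> - sgn (f z) * f z + a * r\<^sup>2"
      using sphere_gain[OF C2 r sub(2), where a = a and s = "- sgn (f z)"] by blast
    have yB: "y \<in> ball z R"
      using y sub by blast
    show ?thesis
      using y(2) abs[OF yB] abs[OF z] m(2)[OF yB] gain z by (intro bexI[of _ z]) auto
  qed
qed

section \<open>The estimate for Dirichlet solutions\<close>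

lemma sup_norm_on_ge:
  fixes f :: "'a::euclidean_space \<Rightarrow> real"
  assumes "bounded U" "continuous_on (closure U) f" "x \<in> U"
  shows "\<bar>f x\<bar> \<le> sup_norm_on U f"
proof -
  have "compact ((\<lambda>y. \<bar>f y\<bar>) ` closure U)"
    using assms by (intro compact_continuous_image continuous_on_rabs) simp_all
  then have "bdd_above ((\<lambda>y. \<bar>f y\<bar>) ` closure U)"
    by (intro bounded_imp_bdd_above compact_imp_bounded)
  then have "bdd_above ((\<lambda>y. \<bar>f y\<bar>) ` U)"
    by (rule bdd_above_mono) (intro image_mono closure_subset)
  then show ?thesis
    unfolding sup_norm_on_def using assms(3) by (rule cSUP_upper2[OF _ _ order_refl])
qed

theorem theorem1:
  shows "\<exists>cn::real. cn > 0 \<and>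
    (\<forall>(\<Omega> :: (real ^ 'n) set) (V :: real ^ 'n \<Rightarrow> real) (\<phi> :: real ^ 'n \<Rightarrow> real)
       (l :: real) (c :: real) (x0 :: real ^ 'n) (B :: (real ^ 'n) set).
       bounded \<Omega> \<longrightarrow> open \<Omega> \<longrightarrow> smooth_boundary \<Omega> \<longrightarrow>
       Ck_on 2 V \<Omega> \<longrightarrow> (\<forall>x\<in>\<Omega>. V x \<ge> 0) \<longrightarrow>
       dirichlet_solution \<Omega> V l \<phi> \<longrightarrow> (\<exists>x\<in>\<Omega>. \<phi> x \<noteq> 0) \<longrightarrow>
       c > 0 \<longrightarrow> x0 \<in> \<Omega> \<longrightarrow> \<phi> x0 \<noteq> 0 \<longrightarrow>
       B = ball x0 (cn / sqrt c * sqrt (l / c + ln (cn * (sup_norm_on \<Omega> \<phi> / \<bar>\<phi> x0\<bar>)))) \<longrightarrow>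
       B \<subseteq> \<Omega> \<longrightarrow>
       (\<forall>x\<in>B. V x - l \<ge> c) \<or> (\<forall>x\<in>B. V x - l \<le> - c) \<longrightarrow>
       sup_inf_quotient B \<phi> \<ge> 2)"
proof (intro exI[of _ "exp (2 * real DIM(real ^ 'n))"] conjI allI impI)
  let ?n = "real DIM(real ^ 'n)"
  let ?k = "exp (2 * ?n)"
  fix \<Omega> :: "(real ^ 'n) set" and V \<phi> :: "real ^ 'n \<Rightarrow> real" and l c :: real
    and x0 :: "real ^ 'n" and B :: "(real ^ 'n) set"
  assume \<Omega>: "bounded \<Omega>" "open \<Omega>" and V: "\<forall>x\<in>\<Omega>. V x \<ge> 0"
    and sol: "dirichlet_solution \<Omega> V l \<phi>" and c: "c > 0"
    and x0: "x0 \<in> \<Omega>" "\<phi> x0 \<noteq> 0"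
    and B: "B = ball x0 (?k / sqrt c * sqrt (l / c + ln (?k * (sup_norm_on \<Omega> \<phi> / \<bar>\<phi> x0\<bar>))))"
    and B_sub: "B \<subseteq> \<Omega>"
    and cases: "(\<forall>x\<in>B. V x - l \<ge> c) \<or> (\<forall>x\<in>B. V x - l \<le> - c)"
  define M where "M = sup_norm_on \<Omega> \<phi> / \<bar>\<phi> x0\<bar>"
  define R where "R = ?k / sqrt c * sqrt (l / c + ln (?k * M))"
  have BR: "B = ball x0 R"
    by (simp add: B R_def M_def)
  have n: "?n > 0"
    by simp
  have "l \<ge> 0"
    using dirichlet_eigenvalue_nonneg[OF \<Omega> _ sol x0] V by blast
  moreover have "M \<ge> 1"
    using sup_norm_on_ge[OF \<Omega>(1) _ x0(1), of \<phi>] sol x0(2)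
    by (simp add: M_def dirichlet_solution_def)
  ultimately have log: "2 * ?n \<le> l / c + ln (?k * M)"
    using c by (simp add: ln_mult)
  \<comment> \<open>Strictness, which leaves room for a closed ball inside \<open>B\<close>, comes from \<open>1 < exp (2 n)\<close>.\<close>
  have "sqrt (2 * ?n / c) = 1 / sqrt c * sqrt (2 * ?n)"
    by (simp add: real_sqrt_divide)
  also have "\<dots> < ?k / sqrt c * sqrt (2 * ?n)"
    using n c by (intro mult_strict_right_mono divide_strict_right_mono) auto
  also have "\<dots> \<le> R"
    unfolding R_def using log c by (intro mult_left_mono) auto
  finally have "sqrt (2 * ?n / c) < R" .
  then obtain r where r: "sqrt (2 * ?n / c) < r" "r < R"
    using dense by blast
  have rpos: "r > 0"
    using r(1) c n by (intro le_less_trans[OF real_sqrt_ge_zero r(1)]) simp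
  have r2: "r\<^sup>2 > 2 * ?n / c"
    using power_strict_mono[OF r(1), of 2] c by simp
  show "sup_inf_quotient B \<phi> \<ge> 2"
  proof (rule sup_inf_quotient_ge_2I[where z = x0])
    show "x0 \<in> B"
      using rpos r(2) by (simp add: BR)
    fix m :: real
    assume m: "m > 0" "\<And>x. x \<in> B \<Longrightarrow> m \<le> \<bar>\<phi> x\<bar>"
    have C2: "Ck_on 2 \<phi> \<Omega>"
      using sol by (simp add: dirichlet_solution_def)
    have pde: "laplacian \<phi> x = (V x - l) * \<phi> x" if "x \<in> \<Omega>" for x
      using sol that by (auto simp: dirichlet_solution_def algebra_simps)
    show "\<exists>y\<in>B. 2 * m \<le> \<bar>\<phi> y\<bar>"
      unfolding BR
    proof (rule doubling_on_large_ball[OF C2 pde c rpos r2 r(2) _ _ m(1)])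
      show "ball x0 R \<subseteq> \<Omega>"
        using B_sub by (simp add: BR)
      show "(\<forall>x\<in>ball x0 R. c \<le> V x - l) \<or> (\<forall>x\<in>ball x0 R. V x - l \<le> - c)"
        using cases by (simp only: BR)
      show "m \<le> \<bar>\<phi> x\<bar>" if "x \<in> ball x0 R" for x
        using m(2) that by (simp only: BR)
    qed
  qed (rule x0)
qed simp

end
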